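(* Let $m,R,\delta$ be positive integers. If $\log^{(2\delta-2)} m \geq 2^{2^{2+2R}}$, then $\chi(U(m,R,\delta)) \leq 2^{2^{2+2R}} \cdot \log^{(2\delta)} m$.
   Context: $\log^{(j)}$ denotes the base-2 logarithm iterated $j$ times ($\log^{(0)}m=m$). A chain of length $f$ and size $s$ in $[m]$ is a nested sequence $A_0\subseteq\cdots\subseteq A_f\subseteq[m]$ with $|A_0|=1$, $|A_f|=s$, written $\langle\alpha,A_1,\dots,A_f\rangle$ where $A_0=\{\alpha\}$. The graph $U(m,R,\delta)$ has as vertices all chains in $[m]$ of length $\delta$ and size at most $R$, and $\langle\alpha,A_1,\dots,A_\delta\rangle$, $\langle\beta,B_1,\dots,B_\delta\rangle$ are adjacent iff $\alpha\neq\beta$, $\alpha\in B_1$, $\beta\in A_1$, and $A_i\subseteq B_{i+1}$, $B_i\subseteq A_{i+1}$ for all $1\le i\le\delta-1$. *)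

theory Defs
  imports Complex_Main
begin

text \<open>
  The library's \<^const>\<open>log\<close> also takes values on non-positive arguments, so merely iterating it
  could turn an undefined iterated logarithm into a large positive number. Here the iteration
  yields 0 from the first undefined iterate on; by \<open>iterlog_pos_imp_defined\<close>, a positive value
  is always a genuine iterated logarithm.
\<close>

fun iterlog :: "nat \<Rightarrow> real \<Rightarrow> real" where
  "iterlog 0 x = x"
| "iterlog (Suc j) x = (if iterlog j x > 0 then log 2 (iterlog j x) else 0)"

lemma iterlog_pos_imp_defined:
  assumes "iterlog j x > 0"
  shows "(\<forall>i\<le>j. ((log 2) ^^ i) x > 0) \<and> iterlog j x = ((log 2) ^^ j) x"
  using assms
proof (induction j)
  case 0
  then show ?case by simp
next
  case (Suc j)
  then have "iterlog j x > 0" by (simp split: if_splits)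
  with Suc show ?case by (auto simp: le_Suc_eq)
qed

text \<open>
  A graph is given by its vertex set and an adjacency relation. Since \<open>LEAST\<close> is used,
  \<open>chromatic_number\<close> is meaningful only for finitely colourable graphs.
\<close>

definition proper_colouring :: "'a set \<Rightarrow> ('a \<Rightarrow> 'a \<Rightarrow> bool) \<Rightarrow> nat \<Rightarrow> ('a \<Rightarrow> nat) \<Rightarrow> bool" where
  "proper_colouring V adj k c \<longleftrightarrow>
     (\<forall>v\<in>V. c v < k) \<and> (\<forall>v\<in>V. \<forall>w\<in>V. adj v w \<longrightarrow> c v \<noteq> c w)"

definition chromatic_number :: "'a set \<Rightarrow> ('a \<Rightarrow> 'a \<Rightarrow> bool) \<Rightarrow> nat" where
  "chromatic_number V adj = (LEAST k. \<exists>c. proper_colouring V adj k c)"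

text \<open>A chain is the list \<open>[A\<^sub>0, \<dots>, A\<^sub>f]\<close>; its length \<open>f\<close> is one less than the list length.\<close>

definition is_chain :: "nat \<Rightarrow> nat \<Rightarrow> nat \<Rightarrow> nat set list \<Rightarrow> bool" where
  "is_chain m f s A \<longleftrightarrow>
     length A = Suc f \<and>
     (\<forall>i<f. A ! i \<subseteq> A ! Suc i) \<and> A ! f \<subseteq> {1..m} \<and>
     card (A ! 0) = 1 \<and> card (A ! f) = s"

definition U_verts :: "nat \<Rightarrow> nat \<Rightarrow> nat \<Rightarrow> nat set list set" where
  "U_verts m R \<delta> = {A. \<exists>s\<le>R. is_chain m \<delta> s A}"

definition U_adj :: "nat \<Rightarrow> nat set list \<Rightarrow> nat set list \<Rightarrow> bool" where
  "U_adj \<delta> A B \<longleftrightarrow>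
     (\<exists>\<alpha> \<beta>. A ! 0 = {\<alpha>} \<and> B ! 0 = {\<beta>} \<and>
        \<alpha> \<noteq> \<beta> \<and> \<alpha> \<in> B ! 1 \<and> \<beta> \<in> A ! 1 \<and>
        (\<forall>i. 1 \<le> i \<and> i \<le> \<delta> - 1 \<longrightarrow> A ! i \<subseteq> B ! Suc i \<and> B ! i \<subseteq> A ! Suc i))"

lemma U_adj_sym: "U_adj \<delta> A B \<Longrightarrow> U_adj \<delta> B A"
  unfolding U_adj_def by metis

lemma U_adj_irrefl: "\<not> U_adj \<delta> A A"
  unfolding U_adj_def by auto

lemma is_chain_nth_subset:
  assumes "is_chain m f s A" and "i \<le> f"
  shows "A ! i \<subseteq> A ! f"
  using \<open>i \<le> f\<close>
proof (induction rule: inc_induct)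
  case base
  then show ?case by simp
next
  case (step n)
  then have "A ! n \<subseteq> A ! Suc n"
    using assms(1) by (simp add: is_chain_def)
  with step.IH show ?case by blast
qed

lemma finite_U_verts: "finite (U_verts m R \<delta>)"
proof (rule finite_subset)
  show "U_verts m R \<delta> \<subseteq> {A. set A \<subseteq> Pow {1..m} \<and> length A = Suc \<delta>}"
  proof
    fix A assume "A \<in> U_verts m R \<delta>"
    then obtain s where A: "is_chain m \<delta> s A"
      by (auto simp: U_verts_def)
    then have len: "length A = Suc \<delta>" and top: "A ! \<delta> \<subseteq> {1..m}"
      by (auto simp: is_chain_def)
    have "A ! i \<subseteq> {1..m}" if "i < length A" for i
      using is_chain_nth_subset[OF A, of i] that len top by fastforce
    then show "A \<in> {A. set A \<subseteq> Pow {1..m} \<and> length A = Suc \<delta>}"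
      using len unfolding in_set_conv_nth subset_iff Pow_iff mem_Collect_eq by metis
  qed
  show "finite {A. set A \<subseteq> Pow {1..m} \<and> length A = Suc \<delta>}"
    by (rule finite_lists_length_eq) simp
qed

lemma finite_graph_colourable:
  assumes "finite V" and irrefl: "\<And>v. \<not> adj v v"
  shows "\<exists>k c. proper_colouring V adj k c"
proof -
  obtain f :: "'a \<Rightarrow> nat" and n where f: "f ` V = {i. i < n}" "inj_on f V"
    using finite_imp_inj_to_nat_seg[OF \<open>finite V\<close>] by blast
  then have "proper_colouring V adj n f"
    unfolding proper_colouring_def using irrefl by (metis imageI inj_onD mem_Collect_eq)
  then show ?thesis by blast
qed

end

theory Submission
  imports Defs
begin

text \<open>
  For a set \<open>X\<close> of numbers let \<open>branch X\<close> be the set of positions at which two elements of \<open>X\<close> have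
  their first differing binary digit. By the ultrametric property it has fewer elements than \<open>X \<noteq> {}\<close>,
  and its elements are at most the logarithm of those of \<open>X\<close>. To a chain \<open>A\<close> assign
  \<open>T\<^sub>j = branch\<^sup>2\<^sup>j A\<^sub>j \<subseteq> X\<^sub>j = branch\<^sup>2\<^sup>j A\<^sub>j\<^sub>+\<^sub>1\<close>, so that \<open>branch (branch X\<^sub>j) = T\<^sub>j\<^sub>+\<^sub>1\<close>.
  The digits of the elements of \<open>T\<^sub>j\<close> at the positions in \<open>branch X\<^sub>j\<close>, where each position is
  recorded only through its own digits at the positions in \<open>T\<^sub>j\<^sub>+\<^sub>1\<close>, are a bounded amount of
  information. If two adjacent chains agree in \<open>T\<^sub>j\<^sub>+\<^sub>1\<close> and in this information, then they agree in
  \<open>T\<^sub>j\<close>; descending to \<open>j = 0\<close> yields equal starting points, which adjacency forbids.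
  Agreement of the last set \<open>T\<^sub>\<delta>\<^sub>-\<^sub>1\<close> is forced by two further colours: its size, and a member of a
  universal family of sets which extends the table of digits of \<open>T\<^sub>\<delta>\<^sub>-\<^sub>1\<close> at the positions in \<open>branch X\<^sub>\<delta>\<^sub>-\<^sub>1\<close>. Since
  the positions range over about \<open>log\<^sup>(\<^sup>2\<^sup>\<delta>\<^sup>-\<^sup>1\<^sup>) m\<close> points, a family of size linear in the next
  logarithm suffices. Only the first \<open>R\<close> levels carry information, as \<open>|X\<^sub>j| \<le> max 0 (R - 2j)\<close>.
\<close>

section \<open>First differing binary digits and branching positions\<close>

definition first_diff :: "nat \<Rightarrow> nat \<Rightarrow> nat" where
  "first_diff x y = (LEAST i. bit x i \<noteq> bit y i)"

lemma first_diff_commute: "first_diff x y = first_diff y x"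
  unfolding first_diff_def by (rule arg_cong[where f = Least]) auto

lemma bit_first_diff:
  assumes "x \<noteq> y"
  shows "bit x (first_diff x y) \<noteq> bit y (first_diff x y)"
proof -
  obtain i where "bit x i \<noteq> bit y i"
    using assms by (auto simp: bit_eq_iff)
  then show ?thesis
    unfolding first_diff_def by (rule LeastI)
qed

lemma bit_below_first_diff: "i < first_diff x y \<Longrightarrow> bit x i = bit y i"
  unfolding first_diff_def using not_less_Least by blast

lemma first_diff_eqI:
  assumes "bit x d \<noteq> bit y d" and "\<And>i. i < d \<Longrightarrow> bit x i = bit y i"
  shows "first_diff x y = d"
  unfolding first_diff_def using assms by (intro Least_equality) (auto simp: not_less[symmetric])

text \<open>The depths at which the binary trie of \<open>X\<close>, read from the least significant
  digit, branches. Excluding \<open>x = y\<close> matters, since \<open>first_diff x x\<close> is an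
  unspecified value.\<close>

definition branch :: "nat set \<Rightarrow> nat set" where
  "branch X = {first_diff x y | x y. x \<in> X \<and> y \<in> X \<and> x \<noteq> y}"

lemma branchI: "x \<in> X \<Longrightarrow> y \<in> X \<Longrightarrow> x \<noteq> y \<Longrightarrow> first_diff x y \<in> branch X"
  unfolding branch_def by blast

lemma branch_mono: "X \<subseteq> Y \<Longrightarrow> branch X \<subseteq> branch Y"
  unfolding branch_def by blast

lemma branch_separates:
  assumes "x \<in> X" "y \<in> X" and "\<And>i. i \<in> branch X \<Longrightarrow> bit x i = bit y i"
  shows "x = y"
  using assms branchI bit_first_diff by metis

lemma finite_branch:
  assumes "finite X"
  shows "finite (branch X)"
proof (rule finite_subset)
  show "branch X \<subseteq> (\<lambda>(x, y). first_diff x y) ` (X \<times> X)"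
    unfolding branch_def by auto
qed (use assms in simp)

lemma branch_insert_subset:
  assumes "finite X" "X \<noteq> {}" "x \<notin> X"
  shows "\<exists>d. branch (insert x X) \<subseteq> insert d (branch X)"
proof -
  txt \<open>Seen from \<open>x\<close>, an element of \<open>X\<close> that is not nearest branches off where it also leaves a
    nearest one.\<close>
  define d where "d = Max (first_diff x ` X)"
  have "d \<in> first_diff x ` X"
    unfolding d_def using assms by (intro Max_in) auto
  then obtain a where a: "a \<in> X" "first_diff x a = d"
    by blast
  have max: "first_diff x b \<le> d" if "b \<in> X" for b
    unfolding d_def using assms that by auto
  have new: "first_diff x b \<in> insert d (branch X)" if b: "b \<in> X" for b
  proof (cases "first_diff x b = d")
    case False
    then have less: "first_diff x b < first_diff x a"
      using max[OF b] a by simp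
    have "x \<noteq> b" using b assms by blast
    have "first_diff a b = first_diff x b"
    proof (rule first_diff_eqI)
      show "bit a (first_diff x b) \<noteq> bit b (first_diff x b)"
        using bit_first_diff[OF \<open>x \<noteq> b\<close>] bit_below_first_diff[OF less] by simp
      show "bit a i = bit b i" if "i < first_diff x b" for i
        using bit_below_first_diff[OF that] bit_below_first_diff[of i x a] that less by simp
    qed
    moreover have "a \<noteq> b" using False a by blast
    ultimately show ?thesis
      using branchI[OF a(1) b] by auto
  qed simp
  have "branch (insert x X) \<subseteq> insert d (branch X)"
  proof
    fix i assume "i \<in> branch (insert x X)"
    then obtain u v where "i = first_diff u v" "u \<in> insert x X" "v \<in> insert x X" "u \<noteq> v"
      unfolding branch_def by blast
    then show "i \<in> insert d (branch X)"
      using new[of u] new[of v] branchI[of u X v] first_diff_commute[of u x] by auto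
  qed
  then show ?thesis by blast
qed

text \<open>Inserting the elements one by one, the first creates no position and each later one at
  most one new position.\<close>

lemma card_branch_le:
  assumes "finite X"
  shows "card (branch X) \<le> card X - 1"
  using assms
proof (induction X rule: finite_induct)
  case empty
  then show ?case by (simp add: branch_def)
next
  case (insert x X)
  show ?case
  proof (cases "X = {}")
    case True
    then show ?thesis by (simp add: branch_def)
  next
    case False
    then obtain d where d: "branch (insert x X) \<subseteq> insert d (branch X)"
      using branch_insert_subset insert.hyps by blast
    have "card (branch (insert x X)) \<le> card (insert d (branch X))"
      using d insert.hyps(1) by (intro card_mono) (simp_all add: finite_branch)
    also have "\<dots> \<le> Suc (card (branch X))"
      by (rule card_insert_le_m1) simp_all
    also have "\<dots> \<le> Suc (card X - 1)"
      using insert.IH by simp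
    also have "\<dots> = card (insert x X) - 1"
      using insert.hyps False by (simp add: card_gt_0_iff)
    finally show ?thesis .
  qed
qed

lemma funpow_branch_mono: "X \<subseteq> Y \<Longrightarrow> (branch ^^ n) X \<subseteq> (branch ^^ n) Y"
  by (induction n) (simp_all add: branch_mono)

lemma finite_funpow_branch: "finite X \<Longrightarrow> finite ((branch ^^ n) X)"
  by (induction n) (simp_all add: finite_branch)

text \<open>Each round costs an element until nothing is left; by truncated subtraction,
  \<open>n\<close> rounds empty any set with at most \<open>n\<close> elements.\<close>

lemma card_funpow_branch_le:
  assumes "finite X"
  shows "card ((branch ^^ n) X) \<le> card X - n"
proof (induction n)
  case (Suc n)
  then show ?case
    using card_branch_le[OF finite_funpow_branch[OF assms], of n] by simp
qed simp

section \<open>Positions bounded by iterated logarithms\<close>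

lemma bit_imp_power_le: "bit (x :: nat) i \<Longrightarrow> 2 ^ i \<le> x"
  by (metis bit_iff_odd div_less even_zero not_less)

lemma le_log2_if_power_le:
  fixes r :: real
  assumes "2 ^ n \<le> r"
  shows "real n \<le> log 2 r"
proof -
  have "(0 :: real) < 2 ^ n" by simp
  then have "r > 0" using assms by linarith
  then show ?thesis
    using assms by (simp add: le_log_iff powr_realpow)
qed

text \<open>Of two numbers that first differ at \<open>d\<close>, one has the digit 1 there and is
  therefore at least \<open>2 ^ d\<close>.\<close>

lemma branch_le_iterlog:
  assumes "\<And>x. x \<in> X \<Longrightarrow> real x \<le> iterlog j r" and "d \<in> branch X"
  shows "real d \<le> iterlog (Suc j) r"
proof -
  obtain x y where xy: "x \<in> X" "y \<in> X" "x \<noteq> y" "d = first_diff x y"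
    using assms(2) unfolding branch_def by blast
  then have "bit x d \<or> bit y d"
    using bit_first_diff by blast
  then obtain z where z: "z \<in> X" "bit z d"
    using xy by blast
  have "2 ^ d \<le> real z"
    using bit_imp_power_le[OF z(2)] by (metis of_nat_le_iff of_nat_numeral of_nat_power)
  then have *: "2 ^ d \<le> iterlog j r"
    using assms(1)[OF z(1)] by linarith
  \<comment> \<open>Rules out the default value 0 of the next iterate.\<close>
  then have pos: "iterlog j r > 0"
    by (smt (verit) zero_less_power)
  then show ?thesis
    using le_log2_if_power_le[OF *] by simp
qed

lemma funpow_branch_le_iterlog:
  assumes "\<And>x. x \<in> X \<Longrightarrow> real x \<le> r" and "d \<in> (branch ^^ n) X"
  shows "real d \<le> iterlog n r"
  using assms(2)
proof (induction n arbitrary: d)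
  case 0
  then show ?case using assms(1) by simp
next
  case (Suc n)
  then show ?case
    using branch_le_iterlog[of "(branch ^^ n) X" n r d] by simp
qed

section \<open>Digit profiles\<close>

definition trace :: "nat set \<Rightarrow> nat \<Rightarrow> nat set" where
  "trace Z y = {z \<in> Z. bit y z}"

text \<open>Replacing each position by its trace confines the profile to \<open>Pow (Pow Z)\<close>
  with \<open>Z = branch (branch X)\<close>, however large the positions are.\<close>

definition profile :: "nat set \<Rightarrow> nat \<Rightarrow> nat set set" where
  "profile X s = trace (branch (branch X)) ` {y \<in> branch X. bit s y}"

text \<open>As both elements lie in both sets, their first difference would be a position in both
  branch sets.\<close>

lemma eq_if_bits_eq_on_common_branch:
  assumes "s \<in> X \<inter> X'" "s' \<in> X \<inter> X'"
    and "\<And>y. y \<in> branch X \<inter> branch X' \<Longrightarrow> bit s y = bit s' y"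
  shows "s = s'"
proof (rule ccontr)
  assume "s \<noteq> s'"
  then have "first_diff s s' \<in> branch X \<inter> branch X'"
    using assms(1,2) by (auto intro: branchI)
  then show False
    using assms(3) bit_first_diff[OF \<open>s \<noteq> s'\<close>] by blast
qed

text \<open>The trace of \<open>y\<close> occurs in the other profile as the trace of some
  \<open>y'\<close> in \<open>branch X'\<close>. Traces on \<open>branch (branch X')\<close>
  separate the elements of \<open>branch X'\<close>, so \<open>y' = y\<close>.\<close>

lemma profile_bitD:
  assumes "profile X s = profile X' s'" and "branch (branch X) = branch (branch X')"
    and "y \<in> branch X" "y \<in> branch X'" "bit s y"
  shows "bit s' y"
proof -
  have "trace (branch (branch X)) y \<in> profile X s"
    using assms(3,5) unfolding profile_def by blast
  then have "trace (branch (branch X')) y \<in> profile X' s'"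
    by (simp only: assms(1,2))
  then obtain y' where y': "y' \<in> branch X'" "bit s' y'"
      "trace (branch (branch X')) y = trace (branch (branch X')) y'"
    unfolding profile_def by blast
  have "bit y z = bit y' z" if "z \<in> branch (branch X')" for z
    using y'(3) that unfolding trace_def by (simp add: set_eq_iff) metis
  then have "y = y'"
    by (rule branch_separates[OF assms(4) y'(1)])
  then show ?thesis using y'(2) by simp
qed

lemma profile_inject:
  assumes "profile X s = profile X' s'" and "branch (branch X) = branch (branch X')"
    and "s \<in> X \<inter> X'" "s' \<in> X \<inter> X'"
  shows "s = s'"
proof (rule eq_if_bits_eq_on_common_branch[OF assms(3,4)])
  fix y assume "y \<in> branch X \<inter> branch X'"
  then have y: "y \<in> branch X" "y \<in> branch X'" by auto
  show "bit s y = bit s' y"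
    using profile_bitD[OF assms(1,2) y] profile_bitD[OF assms(1,2)[symmetric] y(2,1)] by metis
qed

lemma profile_image_subset:
  assumes "profile X ` S = profile X' ` S'" and "branch (branch X) = branch (branch X')"
    and "S \<subseteq> X \<inter> X'" "S' \<subseteq> X \<inter> X'"
  shows "S \<subseteq> S'"
proof
  fix s assume s: "s \<in> S"
  then have "profile X s \<in> profile X' ` S'"
    by (simp flip: assms(1))
  then obtain s' where s': "s' \<in> S'" "profile X s = profile X' s'"
    by (elim imageE)
  have "s = s'"
    using s s'(1) assms(3,4) by (intro profile_inject[OF s'(2) assms(2)]) (simp_all add: subset_iff)
  with s' show "s \<in> S'" by simp
qed

lemma profile_image_inject:
  assumes "profile X ` S = profile X' ` S'" and "branch (branch X) = branch (branch X')"
    and "S \<subseteq> X \<inter> X'" "S' \<subseteq> X \<inter> X'"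
  shows "S = S'"
proof
  show "S \<subseteq> S'"
    by (rule profile_image_subset[OF assms])
  show "S' \<subseteq> S"
    by (rule profile_image_subset[OF assms(1,2)[symmetric]]) (use assms(3,4) in auto)
qed

section \<open>Universal families of sets\<close>

text \<open>Such a set fills \<open>w\<close> slots, each with an element of \<open>G\<close> or
  with nothing (\<open>None\<close>).\<close>

lemma card_bounded_subsets_le:
  assumes "finite G"
  shows "card {W. W \<subseteq> G \<and> card W \<le> w} \<le> (card G + 1) ^ w"
proof (induction w)
  case 0
  have "{W. W \<subseteq> G \<and> card W \<le> 0} = {{}}"
    using assms by (auto dest: finite_subset)
  then show ?case by simp
next
  case (Suc w)
  let ?F = "{W. W \<subseteq> G \<and> card W \<le> w}"
  let ?h = "\<lambda>(u, W). case u of None \<Rightarrow> W | Some x \<Rightarrow> insert x W"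
  have fin: "finite (insert None (Some ` G) \<times> ?F)"
    using assms by simp
  have "{W. W \<subseteq> G \<and> card W \<le> Suc w} \<subseteq> ?h ` (insert None (Some ` G) \<times> ?F)"
  proof
    fix W assume "W \<in> {W. W \<subseteq> G \<and> card W \<le> Suc w}"
    then have W: "W \<subseteq> G" "card W \<le> Suc w" by auto
    have finW: "finite W" using W(1) assms finite_subset by blast
    show "W \<in> ?h ` (insert None (Some ` G) \<times> ?F)"
    proof (cases "W = {}")
      case True
      then show ?thesis by (intro image_eqI[of _ _ "(None, {})"]) auto
    next
      case False
      then obtain x where x: "x \<in> W" by blast
      then show ?thesis
        using W finW by (intro image_eqI[of _ _ "(Some x, W - {x})"]) auto
    qed
  qed
  then have "card {W. W \<subseteq> G \<and> card W \<le> Suc w} \<le> card (insert None (Some ` G) \<times> ?F)"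
    using fin surj_card_le by blast
  also have "\<dots> = (card G + 1) * card ?F"
    using assms by (simp add: card_cartesian_product card_image image_iff)
  also have "\<dots> \<le> (card G + 1) * (card G + 1) ^ w"
    using Suc.IH by (rule mult_left_mono) simp
  finally show ?case by simp
qed

text \<open>Derandomises \<open>M\<close> independent uniform draws from \<open>F\<close>, for which
  the right-hand side bounds the expected number of missed points.\<close>

lemma greedy_cover:
  fixes hit :: "'f \<Rightarrow> 'p \<Rightarrow> bool" and q :: real
  assumes "finite F" "F \<noteq> {}" "finite P" "q \<le> 1"
    and hit: "\<And>p. p \<in> P \<Longrightarrow> q * card F \<le> card {f \<in> F. hit f p}"
  shows "\<exists>g. card {p \<in> P. \<forall>i<M. \<not> hit (g i) p} \<le> (1 - q) ^ M * card P"
proof (induction M)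
  case 0
  show ?case by simp
next
  case (Suc M)
  then obtain g where g: "card {p \<in> P. \<forall>i<M. \<not> hit (g i) p} \<le> (1 - q) ^ M * card P"
    by blast
  define U where "U = {p \<in> P. \<forall>i<M. \<not> hit (g i) p}"
  have finU: "finite U" unfolding U_def using assms by simp
  txt \<open>Averaging over \<open>F\<close>, some \<open>f\<close> hits a fraction \<open>q\<close> of what is left.\<close>
  have "\<exists>f\<in>F. q * card U \<le> card {p \<in> U. hit f p}"
  proof (rule ccontr)
    assume "\<not> ?thesis"
    then have "(\<Sum>f\<in>F. real (card {p \<in> U. hit f p})) < (\<Sum>f\<in>F. q * card U)"
      using assms by (intro sum_strict_mono) (auto simp: not_le)
    also have "\<dots> = (\<Sum>p\<in>U. q * card F)"
      by simp
    also have "\<dots> \<le> (\<Sum>p\<in>U. real (card {f \<in> F. hit f p}))"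
      using hit by (intro sum_mono) (auto simp: U_def)
    also have "\<dots> = (\<Sum>p\<in>U. \<Sum>f\<in>F. of_bool (hit f p))"
      using assms by (simp add: Int_def conj_commute)
    also have "\<dots> = (\<Sum>f\<in>F. \<Sum>p\<in>U. of_bool (hit f p))"
      by (rule sum.swap)
    also have "\<dots> = (\<Sum>f\<in>F. real (card {p \<in> U. hit f p}))"
      using finU by (simp add: Int_def conj_commute)
    finally show False by simp
  qed
  then obtain f where f: "f \<in> F" "q * card U \<le> card {p \<in> U. hit f p}" by blast
  let ?g = "g(M := f)"
  have "{p \<in> P. \<forall>i<Suc M. \<not> hit (?g i) p} = U - {p \<in> U. hit f p}"
    unfolding U_def by (auto simp: less_Suc_eq)
  moreover have "card (U - {p \<in> U. hit f p}) = card U - card {p \<in> U. hit f p}"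
    using finU by (intro card_Diff_subset) auto
  moreover have "card {p \<in> U. hit f p} \<le> card U"
    using finU by (intro card_mono) auto
  ultimately have "real (card {p \<in> P. \<forall>i<Suc M. \<not> hit (?g i) p})
      = real (card U) - card {p \<in> U. hit f p}"
    by simp
  also have "\<dots> \<le> (1 - q) * card U"
    using f(2) by (simp add: algebra_simps)
  also have "\<dots> \<le> (1 - q) * ((1 - q) ^ M * card P)"
    using g assms(4) unfolding U_def by (intro mult_left_mono) auto
  finally have "card {p \<in> P. \<forall>i<Suc M. \<not> hit (?g i) p} \<le> (1 - q) ^ Suc M * card P"
    by simp
  then show ?case by blast
qed

lemma card_sets_with_trace:
  assumes "finite G" "W \<subseteq> G" "V \<subseteq> W"
  shows "card {f \<in> Pow G. f \<inter> W = V} = 2 ^ (card G - card W)"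
proof -
  have "bij_betw (\<lambda>f. f \<union> V) (Pow (G - W)) {f \<in> Pow G. f \<inter> W = V}"
  proof (rule bij_betw_byWitness[where f' = "\<lambda>f. f - W"])
    show "\<forall>f\<in>Pow (G - W). f \<union> V - W = f"
      using assms(3) by blast
    show "\<forall>f\<in>{f \<in> Pow G. f \<inter> W = V}. f - W \<union> V = f"
      by blast
    show "(\<lambda>f. f \<union> V) ` Pow (G - W) \<subseteq> {f \<in> Pow G. f \<inter> W = V}"
      using assms(2,3) by blast
    show "(\<lambda>f. f - W) ` {f \<in> Pow G. f \<inter> W = V} \<subseteq> Pow (G - W)"
      by blast
  qed
  then have "card {f \<in> Pow G. f \<inter> W = V} = card (Pow (G - W))"
    by (rule bij_betw_same_card[symmetric])
  also have "\<dots> = 2 ^ card (G - W)"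
    using assms(1) by (simp add: card_Pow)
  also have "card (G - W) = card G - card W"
    by (rule card_Diff_subset[OF finite_subset[OF assms(2,1)] assms(2)])
  finally show ?thesis .
qed

text \<open>A random subset of \<open>G\<close> has trace \<open>V\<close> on \<open>W\<close> with
  probability at least \<open>1 / 2 ^ w\<close>. There are at most
  \<open>(card G + 1) ^ (2 * w)\<close> pairs, as both members have at most \<open>w\<close>
  elements. So after \<open>M\<close> greedy choices fewer than one pair is missed, hence
  none.\<close>

lemma universal_family_exists:
  fixes G :: "'a set"
  assumes "finite G" and small: "(real (card G) + 1) ^ (2 * w) * (1 - 1 / 2 ^ w) ^ M < (1 :: real)"
  shows "\<exists>g :: nat \<Rightarrow> 'a set. \<forall>W V. W \<subseteq> G \<and> V \<subseteq> W \<and> card W \<le> w \<longrightarrow> (\<exists>i<M. g i \<inter> W = V)"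
proof -
  let ?B = "{W. W \<subseteq> G \<and> card W \<le> w}"
  define P where "P = {(W, V). W \<subseteq> G \<and> V \<subseteq> W \<and> card W \<le> w}"
  have finB: "finite ?B" using assms(1) by simp
  have sub: "P \<subseteq> ?B \<times> ?B"
  proof
    fix p assume "p \<in> P"
    then obtain W V where p: "p = (W, V)" "W \<subseteq> G" "V \<subseteq> W" "card W \<le> w"
      unfolding P_def by blast
    then have "card V \<le> card W"
      using assms(1) by (meson card_mono finite_subset)
    with p show "p \<in> ?B \<times> ?B" by auto
  qed
  then have finP: "finite P"
    using finB finite_subset by blast
  have "card P \<le> card (?B \<times> ?B)"
    using sub finB by (intro card_mono) auto
  also have "\<dots> = card ?B * card ?B"
    by (rule card_cartesian_product)
  also have "\<dots> \<le> (card G + 1) ^ w * (card G + 1) ^ w"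
    using card_bounded_subsets_le[OF assms(1), of w] by (intro mult_le_mono)
  also have "\<dots> = (card G + 1) ^ (2 * w)"
    by (simp add: mult_2 power_add)
  finally have "real (card P) \<le> real ((card G + 1) ^ (2 * w))"
    by (simp only: of_nat_le_iff)
  then have cardP: "real (card P) \<le> (real (card G) + 1) ^ (2 * w)"
    by (simp add: add.commute)
  have "\<exists>g. card {p \<in> P. \<forall>i<M. \<not> (\<lambda>f (W, V). f \<inter> W = V) (g i) p}
      \<le> (1 - 1 / 2 ^ w) ^ M * card P"
  proof (rule greedy_cover[where F = "Pow G"])
    fix p assume "p \<in> P"
    then obtain W V where p: "p = (W, V)" "W \<subseteq> G" "V \<subseteq> W" "card W \<le> w"
      unfolding P_def by blast
    have "card W \<le> card G" using p assms(1) by (simp add: card_mono)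
    then have "(2 :: real) ^ card G = 2 ^ (card G - card W) * 2 ^ card W"
      by (simp flip: power_add)
    also have "\<dots> \<le> 2 ^ (card G - card W) * 2 ^ w"
      using p(4) by (intro mult_left_mono power_increasing) auto
    finally have "1 / 2 ^ w * 2 ^ card G \<le> (2 :: real) ^ (card G - card W)"
      by (simp add: field_simps)
    then show "1 / 2 ^ w * real (card (Pow G))
        \<le> real (card {f \<in> Pow G. (\<lambda>f (W, V). f \<inter> W = V) f p})"
      using card_sets_with_trace[OF assms(1) p(2,3)] assms(1) p(1) by (simp add: card_Pow)
  qed (use assms(1) finP in auto)
  then obtain g where
    "card {p \<in> P. \<forall>i<M. \<not> (\<lambda>f (W, V). f \<inter> W = V) (g i) p} \<le> (1 - 1 / 2 ^ w) ^ M * card P"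
    by blast
  also have "\<dots> \<le> (1 - 1 / 2 ^ w) ^ M * (real (card G) + 1) ^ (2 * w)"
    using cardP by (intro mult_left_mono) auto
  also have "\<dots> < 1"
    using small by (simp add: mult.commute)
  finally have "{p \<in> P. \<forall>i<M. \<not> (\<lambda>f (W, V). f \<inter> W = V) (g i) p} = {}"
    using finP by simp
  then show ?thesis
    unfolding P_def by (intro exI[of _ g]) auto
qed

section \<open>Colour sets and the levels of chains\<close>

lemma chromatic_number_le_card:
  assumes "finite C" "\<And>v. v \<in> V \<Longrightarrow> c v \<in> C"
    and "\<And>v w. v \<in> V \<Longrightarrow> w \<in> V \<Longrightarrow> adj v w \<Longrightarrow> c v \<noteq> c w"
  shows "chromatic_number V adj \<le> card C"
proof -
  obtain h where h: "bij_betw h C {0..<card C}"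
    using assms(1) ex_bij_betw_finite_nat by blast
  have "proper_colouring V adj (card C) (h \<circ> c)"
    unfolding proper_colouring_def
  proof (intro conjI ballI impI)
    show "(h \<circ> c) v < card C" if "v \<in> V" for v
      using bij_betwE[OF h] assms(2)[OF that] by simp
    show "(h \<circ> c) v \<noteq> (h \<circ> c) w" if "v \<in> V" "w \<in> V" "adj v w" for v w
      using bij_betw_imp_inj_on[OF h] assms(2)[OF that(1)] assms(2)[OF that(2)] assms(3)[OF that]
      by (simp add: inj_on_eq_iff)
  qed
  then show ?thesis
    unfolding chromatic_number_def by (blast intro: Least_le)
qed

definition level :: "nat \<Rightarrow> nat set list \<Rightarrow> nat set" where
  "level j A = (branch ^^ (2 * j)) (A ! j)"

text \<open>The index is \<open>Suc j\<close> because adjacency puts the set at index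
  \<open>j\<close> of each chain inside the set at \<open>Suc j\<close> of the other. So for an
  adjacent pair each ambient set contains both levels.\<close>

definition ambient :: "nat \<Rightarrow> nat set list \<Rightarrow> nat set" where
  "ambient j A = (branch ^^ (2 * j)) (A ! Suc j)"

lemma branch_branch_ambient: "branch (branch (ambient j A)) = level (Suc j) A"
  by (simp add: level_def ambient_def)

lemma U_verts_nth:
  assumes "A \<in> U_verts m R \<delta>" "i \<le> \<delta>"
  shows "finite (A ! i)" "card (A ! i) \<le> R"
proof -
  obtain s where s: "s \<le> R" "is_chain m \<delta> s A"
    using assms(1) unfolding U_verts_def by blast
  then have sub: "A ! i \<subseteq> A ! \<delta>" and card: "card (A ! \<delta>) \<le> R" and "A ! \<delta> \<subseteq> {1..m}"
    using is_chain_nth_subset[OF s(2) assms(2)] by (simp_all add: is_chain_def)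
  then have fin: "finite (A ! \<delta>)"
    using finite_subset by blast
  show "finite (A ! i)"
    by (rule finite_subset[OF sub fin])
  show "card (A ! i) \<le> R"
    using card_mono[OF fin sub] card by simp
qed

lemma finite_ambient: "A \<in> U_verts m R \<delta> \<Longrightarrow> j < \<delta> \<Longrightarrow> finite (ambient j A)"
  unfolding ambient_def by (intro finite_funpow_branch U_verts_nth(1)) auto

lemma card_ambient_le:
  assumes "A \<in> U_verts m R \<delta>" "j < \<delta>"
  shows "card (ambient j A) \<le> R - 2 * j"
  using card_funpow_branch_le[OF U_verts_nth(1)[OF assms(1)], of "Suc j" "2 * j"]
    U_verts_nth(2)[OF assms(1), of "Suc j"] assms(2)
  unfolding ambient_def by simp

lemma level_subset_ambient:
  assumes "A \<in> U_verts m R \<delta>" "j < \<delta>"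
  shows "level j A \<subseteq> ambient j A"
  unfolding level_def ambient_def using assms
  by (intro funpow_branch_mono) (auto simp: U_verts_def is_chain_def)

lemma level_subset_ambient_adj:
  assumes "U_adj \<delta> A B" "j < \<delta>"
  shows "level j A \<subseteq> ambient j B"
  unfolding level_def ambient_def
proof (rule funpow_branch_mono)
  show "A ! j \<subseteq> B ! Suc j"
  \<comment> \<open>The nesting condition of \<open>U_adj\<close> starts at index 1; at index 0 the
    inclusion is the membership of the starting point of \<open>A\<close> in
    \<open>B ! 1\<close>.\<close>
  proof (cases "j = 0")
    case True
    then show ?thesis using assms(1) by (auto simp: U_adj_def)
  next
    case False
    then have "1 \<le> j \<and> j \<le> \<delta> - 1" using assms(2) by linarith
    then show ?thesis using assms(1) unfolding U_adj_def by blast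
  qed
qed

lemma level_subset_Int_ambient:
  assumes "A \<in> U_verts m R \<delta>" "B \<in> U_verts m R \<delta>" "U_adj \<delta> A B" "j < \<delta>"
  shows "level j A \<subseteq> ambient j A \<inter> ambient j B"
    and "level j B \<subseteq> ambient j A \<inter> ambient j B"
  using level_subset_ambient[OF assms(1,4)] level_subset_ambient[OF assms(2,4)]
    level_subset_ambient_adj[OF assms(3,4)] level_subset_ambient_adj[OF U_adj_sym[OF assms(3)] assms(4)]
  by simp_all

lemma level_0_neq:
  assumes "U_adj \<delta> A B"
  shows "level 0 A \<noteq> level 0 B"
  using assms unfolding U_adj_def level_def by auto

text \<open>Downward induction: once the levels at \<open>Suc l\<close> agree,
  \<open>profile_image_inject\<close> recovers level \<open>l\<close>. Agreement of profiles is
  demanded only under that condition, since their codes are comparable only then.\<close>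

lemma levels_eq_descend:
  assumes V: "A \<in> U_verts m R \<delta>" "B \<in> U_verts m R \<delta>" and adj: "U_adj \<delta> A B"
    and "i \<le> j" "j < \<delta>" "level j A = level j B"
    and prof: "\<And>l. l < min R j \<Longrightarrow> level (Suc l) A = level (Suc l) B \<Longrightarrow>
      profile (ambient l A) ` level l A = profile (ambient l B) ` level l B"
  shows "level i A = level i B"
  using \<open>i \<le> j\<close>
proof (induction rule: inc_induct)
  case base
  show ?case by fact
next
  case (step l)
  then have l: "l < \<delta>" using \<open>j < \<delta>\<close> by simp
  note sub = level_subset_Int_ambient[OF V adj l]
  show ?case
  proof (cases "l < R")
    case True
    then have "profile (ambient l A) ` level l A = profile (ambient l B) ` level l B"
      using prof step by simp
    then show ?thesis
      by (rule profile_image_inject) (use sub step.IH in \<open>simp_all add: branch_branch_ambient\<close>)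
  next
    case False
    \<comment> \<open>Here \<open>R - 2 * l\<close> is 0, and both levels lie in the empty
      \<open>ambient l A\<close>.\<close>
    then have "card (ambient l A) = 0"
      using card_ambient_le[OF V(1) l] by simp
    then have "ambient l A = {}"
      using finite_ambient[OF V(1) l] by simp
    then show ?thesis using sub by simp
  qed
qed

section \<open>Components of the colours\<close>

text \<open>Naming the elements of \<open>S\<close> by their ranks keeps the table inside a product
  of positions and small indices, whatever the size of the elements.\<close>

definition bit_table :: "nat set \<Rightarrow> nat set \<Rightarrow> (nat \<times> nat) set" where
  "bit_table X S =
     {(y, i). y \<in> branch X \<and> i < card S \<and> bit (sorted_list_of_set S ! i) y}"

text \<open>Both tables are read off the same \<open>F\<close>, so elements of equal rank have the
  same digits at all common positions, and these separate them. Equal cardinality makes the ranks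
  correspond.\<close>

lemma eq_if_bit_tables_agree:
  assumes "finite X" "finite X'" and S: "S \<subseteq> X \<inter> X'" and S': "S' \<subseteq> X \<inter> X'" and card: "card S = card S'"
    and F: "F \<inter> branch X \<times> {..<card S} = bit_table X S"
    and F': "F \<inter> branch X' \<times> {..<card S'} = bit_table X' S'"
  shows "S = S'"
proof -
  have fin: "finite S" "finite S'"
    using assms(1) S S' by (auto intro: finite_subset)
  have "sorted_list_of_set S = sorted_list_of_set S'"
  proof (rule nth_equalityI)
    show "length (sorted_list_of_set S) = length (sorted_list_of_set S')"
      using card by simp
    fix i assume "i < length (sorted_list_of_set S)"
    then have i: "i < card S" "i < card S'"
      using card by simp_all
    then have mem: "sorted_list_of_set S ! i \<in> S" "sorted_list_of_set S' ! i \<in> S'"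
      using fin nth_mem[of i "sorted_list_of_set S"] nth_mem[of i "sorted_list_of_set S'"] by simp_all
    show "sorted_list_of_set S ! i = sorted_list_of_set S' ! i"
    proof (rule eq_if_bits_eq_on_common_branch[of _ X X'])
      fix y assume y: "y \<in> branch X \<inter> branch X'"
      have "bit (sorted_list_of_set S ! i) y \<longleftrightarrow> (y, i) \<in> bit_table X S"
        using y i by (simp add: bit_table_def)
      also have "\<dots> \<longleftrightarrow> (y, i) \<in> F"
        using y i by (simp flip: F)
      also have "\<dots> \<longleftrightarrow> (y, i) \<in> bit_table X' S'"
        using y i by (simp flip: F')
      also have "\<dots> \<longleftrightarrow> bit (sorted_list_of_set S' ! i) y"
        using y i by (simp add: bit_table_def)
      finally show "bit (sorted_list_of_set S ! i) y = bit (sorted_list_of_set S' ! i) y" .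
    qed (use mem S S' in auto)
  qed
  then show ?thesis
    using fin by (metis set_sorted_list_of_set)
qed

definition profile_sets :: "nat \<Rightarrow> nat set \<Rightarrow> nat set set set set" where
  "profile_sets R Z = {F. F \<subseteq> Pow (Pow Z) \<and> card F \<le> R}"

lemma profile_image_in_profile_sets:
  assumes "finite S" "card S \<le> R" "branch (branch X) = Z"
  shows "profile X ` S \<in> profile_sets R Z"
proof -
  have "profile X ` S \<subseteq> Pow (Pow Z)"
    using assms(3) by (auto simp: profile_def trace_def)
  then show ?thesis
    using card_image_le[OF assms(1), of "profile X"] assms(2) by (simp add: profile_sets_def)
qed

text \<open>Each \<open>Z\<close> has its own coding, but the number of codes depends on
  \<open>R\<close> alone. Colours need not record \<open>Z\<close>, because the descent compares
  codes only once \<open>Z\<close> is known to be common.\<close>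

lemma profile_sets_coding:
  "\<exists>e. \<forall>Z. finite Z \<and> card Z \<le> R \<longrightarrow>
     inj_on (e Z) (profile_sets R Z) \<and> e Z ` profile_sets R Z \<subseteq> {..<(2 ^ 2 ^ R + 1) ^ R :: nat}"
proof -
  have "\<exists>h. finite Z \<and> card Z \<le> R \<longrightarrow>
     inj_on h (profile_sets R Z) \<and> h ` profile_sets R Z \<subseteq> {..<(2 ^ 2 ^ R + 1) ^ R :: nat}" for Z
  proof (cases "finite Z \<and> card Z \<le> R")
    case True
    then have fin: "finite (Pow (Pow Z))" by simp
    then have finP: "finite (profile_sets R Z)" by (simp add: profile_sets_def)
    have "card (profile_sets R Z) \<le> (card (Pow (Pow Z)) + 1) ^ R"
      unfolding profile_sets_def by (rule card_bounded_subsets_le[OF fin])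
    also have "\<dots> = (2 ^ 2 ^ card Z + 1) ^ R"
      using True by (simp add: card_Pow)
    also have "\<dots> \<le> (2 ^ 2 ^ R + 1) ^ R"
      using True by (intro power_mono add_right_mono power_increasing) auto
    finally have card: "card (profile_sets R Z) \<le> (2 ^ 2 ^ R + 1) ^ R" .
    obtain h where h: "bij_betw h (profile_sets R Z) {0..<card (profile_sets R Z)}"
      using finP ex_bij_betw_finite_nat by blast
    have "h ` profile_sets R Z \<subseteq> {..<(2 ^ 2 ^ R + 1) ^ R}"
      using bij_betw_imp_surj_on[OF h] card by auto
    then show ?thesis
      using bij_betw_imp_inj_on[OF h] by blast
  qed blast
  then show ?thesis by metis
qed

section \<open>The colouring\<close>

text \<open>A colour lists the codes of the profile sets below the top level, the size of the top
  level, and the index of a family member extending its table. The bound \<open>R * R\<close> allows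
  for at most \<open>R\<close> positions and at most \<open>R\<close> ranks.\<close>

lemma chromatic_number_U_le:
  fixes g :: "nat \<Rightarrow> (nat \<times> nat) set"
  assumes "\<delta> > 0"
    and range: "\<And>A. A \<in> U_verts m R \<delta> \<Longrightarrow> branch (ambient (\<delta> - 1) A) \<subseteq> {..N}"
    and g: "\<And>W V. W \<subseteq> {..N} \<times> {..<R} \<Longrightarrow> V \<subseteq> W \<Longrightarrow> card W \<le> R * R \<Longrightarrow> \<exists>i<M. g i \<inter> W = V"
  shows "chromatic_number (U_verts m R \<delta>) (U_adj \<delta>) \<le> ((2 ^ 2 ^ R + 1) ^ R) ^ R * ((R + 1) * M)"
proof -
  define K :: nat where "K = (2 ^ 2 ^ R + 1) ^ R"
  obtain e :: "nat set \<Rightarrow> nat set set set \<Rightarrow> nat" where e: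
    "\<And>Z. finite Z \<Longrightarrow> card Z \<le> R \<Longrightarrow> inj_on (e Z) (profile_sets R Z)"
    "\<And>Z. finite Z \<Longrightarrow> card Z \<le> R \<Longrightarrow> e Z ` profile_sets R Z \<subseteq> {..<K}"
    using profile_sets_coding[of R] unfolding K_def by metis
  let ?top = "\<delta> - 1"
  \<comment> \<open>Levels from index \<open>R\<close> on are empty, so at most \<open>R\<close>
    codes are recorded, whatever \<delta> is.\<close>
  let ?r = "min R ?top"
  define code where "code A j = e (level (Suc j) A) (profile (ambient j A) ` level j A)" for A j
  define dom where "dom A = branch (ambient ?top A) \<times> {..<card (level ?top A)}" for A
  define idx where "idx A = (SOME i. i < M \<and> g i \<inter> dom A = bit_table (ambient ?top A) (level ?top A))" for A
  define col where "col A = (map (code A) [0..<?r], card (level ?top A), idx A)" for A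
  define Cols where "Cols = {xs. set xs \<subseteq> {..<K} \<and> length xs = ?r} \<times> {..R} \<times> {..<M}"
  have finite_level: "finite (level j A)" and card_level: "card (level j A) \<le> R"
    if "A \<in> U_verts m R \<delta>" "j \<le> \<delta>" for A j
    using U_verts_nth[OF that] finite_funpow_branch[of "A ! j" "2 * j"]
      card_funpow_branch_le[of "A ! j" "2 * j"]
    unfolding level_def by simp_all
  have prof_mem: "profile (ambient j A) ` level j A \<in> profile_sets R (level (Suc j) A)"
    if "A \<in> U_verts m R \<delta>" "j < \<delta>" for A j
    using that by (intro profile_image_in_profile_sets finite_level card_level branch_branch_ambient) simp_all
  have idx: "idx A < M \<and> g (idx A) \<inter> dom A = bit_table (ambient ?top A) (level ?top A)"
    if A: "A \<in> U_verts m R \<delta>" for A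
  proof -
    have top: "?top < \<delta>" using assms(1) by simp
    have card: "card (level ?top A) \<le> R" using A by (simp add: card_level)
    have "\<exists>i<M. g i \<inter> dom A = bit_table (ambient ?top A) (level ?top A)"
    proof (rule g)
      show "dom A \<subseteq> {..N} \<times> {..<R}"
        using range[OF A] card unfolding dom_def by auto
      show "bit_table (ambient ?top A) (level ?top A) \<subseteq> dom A"
        unfolding dom_def bit_table_def by auto
      have "card (branch (ambient ?top A)) \<le> R"
        using card_branch_le[OF finite_ambient[OF A top]] card_ambient_le[OF A top] by linarith
      then show "card (dom A) \<le> R * R"
        using card unfolding dom_def by (simp add: card_cartesian_product mult_le_mono)
    qed
    then show ?thesis
      unfolding idx_def by (rule someI_ex)
  qed
  have "chromatic_number (U_verts m R \<delta>) (U_adj \<delta>) \<le> card Cols"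
  proof (rule chromatic_number_le_card[where c = col])
    show "finite Cols"
      unfolding Cols_def by (simp add: finite_lists_length_eq)
    show "col A \<in> Cols" if A: "A \<in> U_verts m R \<delta>" for A
    proof -
      have "code A j < K" if "j < ?r" for j
      proof -
        have j: "j < \<delta>" "Suc j \<le> \<delta>" using that by auto
        show ?thesis
          using e(2)[OF finite_level[OF A j(2)] card_level[OF A j(2)]] prof_mem[OF A j(1)]
          unfolding code_def by blast
      qed
      then show ?thesis
        using idx[OF A] card_level[OF A, of ?top] unfolding col_def Cols_def by auto
    qed
    show "col A \<noteq> col B"
      if A: "A \<in> U_verts m R \<delta>" and B: "B \<in> U_verts m R \<delta>" and adj: "U_adj \<delta> A B" for A B
    proof
      assume eq: "col A = col B"
      have top: "?top < \<delta>" using assms(1) by simp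
      have "level ?top A = level ?top B"
      proof (rule eq_if_bit_tables_agree)
        show "card (level ?top A) = card (level ?top B)"
          using eq by (simp add: col_def)
        show "g (idx A) \<inter> branch (ambient ?top A) \<times> {..<card (level ?top A)}
            = bit_table (ambient ?top A) (level ?top A)"
          using idx[OF A] by (simp add: dom_def)
        have "idx A = idx B" using eq by (simp add: col_def)
        then show "g (idx A) \<inter> branch (ambient ?top B) \<times> {..<card (level ?top B)}
            = bit_table (ambient ?top B) (level ?top B)"
          using idx[OF B] by (simp add: dom_def)
      qed (use finite_ambient[OF A top] finite_ambient[OF B top]
             level_subset_Int_ambient[OF A B adj top] in simp_all)
      then have "level 0 A = level 0 B"
      proof (rule levels_eq_descend[OF A B adj le0 top])
        fix l assume l: "l < ?r" and Z: "level (Suc l) A = level (Suc l) B"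
        have l': "l < \<delta>" "Suc l \<le> \<delta>" using l by auto
        have "code A l = code B l"
          using eq l unfolding col_def by (auto dest: map_eq_conv[THEN iffD1])
        \<comment> \<open>Agreement of the levels at \<open>Suc l\<close> makes both codes values of
          one coding, so its injectivity applies.\<close>
        then have "e (level (Suc l) A) (profile (ambient l A) ` level l A)
            = e (level (Suc l) A) (profile (ambient l B) ` level l B)"
          by (simp add: code_def Z)
        then show "profile (ambient l A) ` level l A = profile (ambient l B) ` level l B"
          using inj_onD[OF e(1)[OF finite_level[OF A l'(2)] card_level[OF A l'(2)]]]
            prof_mem[OF A l'(1)] prof_mem[OF B l'(1)] Z by simp
      qed
      then show False
        using level_0_neq[OF adj] by simp
    qed
  qed
  also have "card Cols = K ^ ?r * ((R + 1) * M)"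
    unfolding Cols_def by (simp add: card_cartesian_product card_lists_length_eq)
  also have "\<dots> \<le> K ^ R * ((R + 1) * M)"
    unfolding K_def by (intro mult_le_mono1 power_increasing) auto
  finally show ?thesis
    unfolding K_def .
qed

section \<open>Numerical estimates and the final bound\<close>

lemma square_le_double_power: "n * n \<le> 2 * 2 ^ n" for n :: nat
proof (induction n)
  case (Suc n)
  have "Suc n \<le> 2 ^ n"
    using less_exp[of n] by linarith
  then have "n * n + (2 * n + 1) \<le> 2 * 2 ^ n + 2 * 2 ^ n"
    using Suc.IH by linarith
  then show ?case by simp
qed simp

text \<open>The summands are exponents of powers of two that bound, in turn, the number of code
  lists, \<open>R + 1\<close>, the inverse hitting probability, and \<open>4 * (R * R) + 1\<close>.
  With \<open>x = 2 ^ R\<close> and \<open>R * R \<le> 2 * x\<close>, a quadratic inequality in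
  \<open>x\<close> remains, which \<open>x \<ge> 4\<close> settles; \<open>R = 1\<close> is
  evaluated.\<close>

lemma exponent_bound:
  fixes R :: nat
  assumes "R > 0"
  shows "(2 ^ R + 1) * (R * R) + R + R * R + (R + 4) \<le> 2 ^ (2 + 2 * R)"
proof (cases "R = 1")
  case False
  define x :: nat where "x = 2 ^ R"
  have "2 ^ 2 \<le> x"
    unfolding x_def using assms False by (intro power_increasing) auto
  then have x: "4 \<le> x" by simp
  have R: "R \<le> x" "R * R \<le> 2 * x"
    unfolding x_def using less_exp[of R] square_le_double_power by auto
  have "(x + 2) * (R * R) \<le> (x + 2) * (2 * x)"
    using R(2) by (rule mult_left_mono) simp
  moreover have "4 * x \<le> x * x"
    using x by (rule mult_right_mono) simp
  ultimately have "(x + 2) * (R * R) + 2 * R + 4 \<le> 4 * (x * x)"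
    using R(1) x unfolding add_mult_distrib by linarith
  then have "(x + 1) * (R * R) + R + R * R + (R + 4) \<le> 4 * (x * x)"
    by (simp add: algebra_simps)
  also have "4 * (x * x) = 2 ^ (2 + 2 * R)"
    by (simp add: x_def power_add mult_2)
  finally show ?thesis
    by (simp add: x_def)
qed simp

text \<open>With \<open>L = log 2 L1\<close>, the first factor is at most
  \<open>exp (4 * w * L)\<close> because \<open>ln L1 \<le> L\<close>, and the second at most
  \<open>exp (- M / 2 ^ w)\<close> because \<open>1 - t \<le> exp (- t)\<close>. Hence
  \<open>M\<close> need only be linear in \<open>L\<close>.\<close>

lemma universal_family_size:
  fixes L1 :: real and w c :: nat
  assumes "L1 \<ge> 1" "c + 1 \<le> L1 * L1" "M > 2 ^ w * (4 * w * log 2 L1)"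
  shows "(real c + 1) ^ (2 * w) * (1 - 1 / 2 ^ w) ^ M < 1"
proof -
  define L where "L = log 2 L1"
  have "L \<ge> 0" "ln 2 \<le> (1 :: real)"
    using assms(1) ln_le_minus_one[of "2 :: real"] by (simp_all add: L_def)
  have "ln L1 = ln 2 * L"
    by (simp add: L_def log_def)
  also have "\<dots> \<le> 1 * L"
    by (rule mult_right_mono) fact+
  finally have "exp (ln L1) \<le> exp L"
    by simp
  moreover have "exp (ln L1) = L1"
    using assms(1) by (intro exp_ln) simp
  ultimately have L1: "L1 \<le> exp L"
    by simp
  have "real c + 1 \<le> exp L * exp L"
    using assms(2) mult_mono[OF L1 L1 exp_ge_zero] assms(1) by linarith
  also have "\<dots> = exp (2 * L)"
    by (simp flip: exp_add)
  finally have "(real c + 1) ^ (2 * w) \<le> (exp (2 * L)) ^ (2 * w)"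
    by (rule power_mono) simp
  also have "\<dots> = exp (real (2 * w) * (2 * L))"
    by (rule exp_of_nat_mult[symmetric])
  also have "\<dots> = exp (4 * w * L)"
    by simp
  finally have 1: "(real c + 1) ^ (2 * w) \<le> exp (4 * w * L)" .
  have "(1 - 1 / 2 ^ w) ^ M \<le> (exp (- (1 / 2 ^ w)) :: real) ^ M"
  proof (rule power_mono)
    show "1 - 1 / 2 ^ w \<le> (exp (- (1 / 2 ^ w)) :: real)"
      using exp_ge_add_one_self[of "- (1 / 2 ^ w)"] by simp
    show "0 \<le> 1 - 1 / (2 :: real) ^ w"
      by simp
  qed
  also have "\<dots> = exp (real M * - (1 / 2 ^ w))"
    by (rule exp_of_nat_mult[symmetric])
  also have "\<dots> = exp (- (M / 2 ^ w))"
    by simp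
  finally have 2: "(1 - 1 / 2 ^ w) ^ M \<le> exp (- (M / 2 ^ w))" .
  have "(real c + 1) ^ (2 * w) * (1 - 1 / 2 ^ w) ^ M \<le> exp (4 * w * L) * exp (- (M / 2 ^ w))"
    by (rule mult_mono[OF 1 2]) simp_all
  also have "\<dots> = exp (4 * w * L - M / 2 ^ w)"
    by (simp flip: exp_add)
  also have "\<dots> < 1"
    using assms(3) by (simp add: L_def field_simps)
  finally show ?thesis .
qed

theorem theorem3p2:
  fixes m R \<delta> :: nat
  assumes "m > 0" and "R > 0" and "\<delta> > 0"
    and "iterlog (2 * \<delta> - 2) (real m) \<ge> 2 ^ (2 ^ (2 + 2 * R))"
  shows "real (chromatic_number (U_verts m R \<delta>) (U_adj \<delta>))
           \<le> 2 ^ (2 ^ (2 + 2 * R)) * iterlog (2 * \<delta>) (real m)"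
proof -
  \<comment> \<open>Three consecutive iterates: the hypothesis bounds \<open>L0\<close> from below,
    \<open>L1\<close> bounds the positions at the top level, and \<open>L\<close> is the logarithm
    in the claim.\<close>
  define L0 where "L0 = iterlog (2 * \<delta> - 2) (real m)"
  define L1 where "L1 = log 2 L0"
  define L where "L = log 2 L1"
  have "(1 :: real) \<le> 2 ^ (2 ^ (2 + 2 * R))" "(1 :: real) \<le> 2 ^ (2 + 2 * R)"
    by (rule one_le_power; simp)+
  have L0: "L0 > 0" "2 ^ (2 ^ (2 + 2 * R)) \<le> L0"
    using assms(4) \<open>1 \<le> 2 ^ (2 ^ (2 + 2 * R))\<close> unfolding L0_def by linarith+
  have L1: "2 ^ (2 + 2 * R) \<le> L1"
    using le_log2_if_power_le[OF L0(2)] unfolding L1_def by simp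
  have "L1 > 0"
    using L1 \<open>1 \<le> 2 ^ (2 + 2 * R)\<close> by linarith
  have "real (2 + 2 * R) \<le> L"
    using le_log2_if_power_le[OF L1] unfolding L_def .
  then have L: "L \<ge> 1" by simp
  obtain d where d: "\<delta> = Suc d" using assms(3) gr0_implies_Suc by blast
  have it1: "iterlog (Suc (2 * d)) (real m) = L1" and it2: "iterlog (2 * \<delta>) (real m) = L"
    using L0(1) \<open>L1 > 0\<close> by (simp_all add: L0_def L1_def L_def d)
  define N where "N = nat \<lfloor>L1\<rfloor>"
  \<comment> \<open>The least natural number strictly above the threshold of
    \<open>universal_family_size\<close> for \<open>w = R * R\<close>.\<close>
  define M where "M = nat \<lfloor>2 ^ (R * R) * (4 * (R * R) * L)\<rfloor> + 1"
  let ?G = "{..N} \<times> {..<R}"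
  have "0 \<le> 2 ^ (R * R) * (4 * (R * R) * L)"
    using L by simp
  then have M: "2 ^ (R * R) * (4 * (R * R) * L) < M" "M \<le> 2 ^ (R * R) * (4 * (R * R) * L) + 1"
    unfolding M_def by linarith+
  \<comment> \<open>Needed to absorb the ranks: the ground set has about \<open>L1 * R\<close>
    points, which must stay below \<open>L1 * L1\<close>.\<close>
  have "2 * R + 1 \<le> 2 ^ (2 * R)"
    using less_exp[of "2 * R"] by linarith
  then have "real (2 * R + 1) \<le> real (2 ^ (2 * R))"
    by (simp only: of_nat_le_iff)
  then have R: "2 * real R + 1 \<le> L1"
    using L1 by (simp add: power_add)
  have "L1 \<ge> 1" using L1 \<open>1 \<le> 2 ^ (2 + 2 * R)\<close> by linarith
  have "real (card ?G + 1) = (real N + 1) * R + 1"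
    by (simp add: card_cartesian_product algebra_simps)
  also have "\<dots> \<le> (L1 + 1) * R + 1"
    using \<open>L1 > 0\<close> unfolding N_def by (intro add_right_mono mult_right_mono) auto
  also have "\<dots> \<le> L1 * (2 * R + 1)"
    using mult_right_mono[OF \<open>L1 \<ge> 1\<close>, of "real R"] \<open>L1 \<ge> 1\<close> by (simp add: algebra_simps)
  also have "\<dots> \<le> L1 * L1"
    using R \<open>L1 > 0\<close> by (intro mult_left_mono) auto
  finally have "(real (card ?G) + 1) ^ (2 * (R * R)) * (1 - 1 / 2 ^ (R * R)) ^ M < 1"
    using \<open>L1 \<ge> 1\<close> M(1) by (intro universal_family_size) (simp_all add: L_def)
  then have "\<exists>g :: nat \<Rightarrow> (nat \<times> nat) set. \<forall>W V. W \<subseteq> ?G \<and> V \<subseteq> W \<and> card W \<le> R * R \<longrightarrow>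
      (\<exists>i<M. g i \<inter> W = V)"
    by (intro universal_family_exists) simp_all
  then obtain g :: "nat \<Rightarrow> (nat \<times> nat) set" where
    g: "\<forall>W V. W \<subseteq> ?G \<and> V \<subseteq> W \<and> card W \<le> R * R \<longrightarrow> (\<exists>i<M. g i \<inter> W = V)"
    by blast
  have "chromatic_number (U_verts m R \<delta>) (U_adj \<delta>) \<le> ((2 ^ 2 ^ R + 1) ^ R) ^ R * ((R + 1) * M)"
  proof (rule chromatic_number_U_le[OF assms(3)])
    show "branch (ambient (\<delta> - 1) A) \<subseteq> {..N}" if "A \<in> U_verts m R \<delta>" for A
    proof
      fix y assume "y \<in> branch (ambient (\<delta> - 1) A)"
      \<comment> \<open>\<open>2 * d\<close> rounds come from \<open>ambient\<close> and one more
        from the outer \<open>branch\<close>, hence the iterate \<open>L1\<close>.\<close>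
      then have y: "y \<in> (branch ^^ Suc (2 * d)) (A ! \<delta>)"
        by (simp add: ambient_def d)
      have "A ! \<delta> \<subseteq> {1..m}"
        using that by (auto simp: U_verts_def is_chain_def)
      then have "real x \<le> real m" if "x \<in> A ! \<delta>" for x
        using that by auto
      then have "real y \<le> L1"
        using funpow_branch_le_iterlog[OF _ y] it1 by blast
      then show "y \<in> {..N}"
        unfolding N_def by (simp add: le_nat_floor)
    qed
    show "\<exists>i<M. g i \<inter> W = V" if "W \<subseteq> ?G" "V \<subseteq> W" "card W \<le> R * R" for W V
      using g that by blast
  qed
  then have "real (chromatic_number (U_verts m R \<delta>) (U_adj \<delta>))
      \<le> real (((2 ^ 2 ^ R + 1) ^ R) ^ R * ((R + 1) * M))"
    by (simp only: of_nat_le_iff)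
  also have "\<dots> = (2 ^ 2 ^ R + 1) ^ (R * R) * ((real R + 1) * M)"
    by (simp only: power_mult of_nat_mult of_nat_power of_nat_add of_nat_numeral of_nat_1)
  also have "\<dots> \<le> 2 ^ ((2 ^ R + 1) * (R * R)) * (2 ^ R * (2 ^ (R * R) * 2 ^ (R + 4) * L))"
  proof (intro mult_mono)
    have "(2 ^ 2 ^ R + 1) ^ (R * R) \<le> (2 ^ (2 ^ R + 1) :: real) ^ (R * R)"
      by (intro power_mono) simp_all
    then show "(2 ^ 2 ^ R + 1) ^ (R * R) \<le> (2 :: real) ^ ((2 ^ R + 1) * (R * R))"
      by (simp only: power_mult)
    have "R + 1 \<le> 2 ^ R"
      using less_exp[of R] by linarith
    then have "real (R + 1) \<le> real (2 ^ R)"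
      by (simp only: of_nat_le_iff)
    then show "real R + 1 \<le> 2 ^ R" by simp
    have "4 * (R * R) + 1 \<le> 2 ^ R * 16"
      using square_le_double_power[of R] less_exp[of R] by linarith
    then have "4 * (R * R) + 1 \<le> 2 ^ (R + 4)"
      by (simp add: power_add)
    then have sq: "real (4 * (R * R) + 1) \<le> real (2 ^ (R + 4))"
      by (simp only: of_nat_le_iff)
    \<comment> \<open>Absorbs the 1 that was added in rounding \<open>M\<close> up.\<close>
    have "1 * 1 \<le> 2 ^ (R * R) * L"
      using L by (intro mult_mono) auto
    then have "real M \<le> 2 ^ (R * R) * real (4 * (R * R) + 1) * L"
      using M(2) by (simp add: algebra_simps)
    also have "\<dots> \<le> 2 ^ (R * R) * 2 ^ (R + 4) * L"
      using sq L by (intro mult_right_mono mult_left_mono) auto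
    finally show "real M \<le> 2 ^ (R * R) * 2 ^ (R + 4) * L" .
  qed (use L in auto)
  also have "\<dots> = 2 ^ ((2 ^ R + 1) * (R * R) + R + R * R + (R + 4)) * L"
    by (simp only: power_add mult.assoc)
  also have "\<dots> \<le> 2 ^ (2 ^ (2 + 2 * R)) * L"
    using exponent_bound[OF assms(2)] L by (intro mult_right_mono power_increasing) auto
  finally show ?thesis
    by (simp only: it2)
qed

end
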